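(* Let $\gamma:J\to\mathcal S$ be a natural parametrization of a generic transversal curve, with bending $\kappa$ and twist $\tau$. Then there exists a first order frame field $\mathcal F=(F_1,F_2,F_3):J\to G$ along $\gamma$ such that $F_1$ is a Wilczynski lift of $\gamma$ and $$\mathcal F^{-1}\mathcal F'=\begin{pmatrix}i\kappa&-i&\tau\\0&-2i\kappa&1\\1&0&i\kappa\end{pmatrix}.$$ Such an $\mathcal F$ is called a Wilczynski frame. If $\mathcal F$ is a Wilczynski frame along $\gamma$, any other Wilczynski frame along $\gamma$ is given by $\varepsilon\mathcal F$, where $\varepsilon$ is a cube root of unity.
   Context: $\mathbb C^{2,1}$ is $\mathbb C^3$ with the Hermitian form $\langle \mathbf z,\mathbf w\rangle={}^t\overline{\mathbf z}\,\mathbf h\,\mathbf w$, $\mathbf h=\begin{pmatrix}0&0&i\\0&1&0\\-i&0&0\end{pmatrix}$. $\mathcal N$ is the set of nonzero null vectors and $\mathcal S=\{[\mathbf z]\in\mathbb{CP}^2:\langle\mathbf z,\mathbf z\rangle=0\}$, with contact form $\zeta$ equal to the restriction to $T\mathcal S$ of $-i\langle\mathbf z,d\mathbf z\rangle/({}^t\overline{\mathbf z}\mathbf z)$. $G=\{A\in SL(3,\mathbb C):{}^t\bar A\mathbf hA=\mathbf h\}$. Let $J\subseteq\mathbb R$ be an interval. A lift of a smooth curve $\gamma:J\to\mathcal S$ is a smooth map $\Gamma:J\to\mathcal N$ with $\gamma=[\Gamma]$. $\gamma$ is transversal if $\zeta(\gamma')\ne0$ everywhere; transversal curves are always assumed positively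 parametrized, $\zeta(\gamma')>0$, i.e. $-i\langle\Gamma,\Gamma'\rangle>0$. $\gamma$ is generic if $\det(\Gamma,\Gamma',\Gamma'')$ is nowhere zero. A Wilczynski lift is a lift with $\det(\Gamma,\Gamma',\Gamma'')=-1$; it is unique up to a cube root of unity. The parametrization is natural if $i\langle\Gamma,\Gamma'\rangle^{-1}=1$ for a Wilczynski lift $\Gamma$. For a natural parametrization, the bending and twist are the real functions $\kappa=\frac12\langle\Gamma',\Gamma'\rangle$ and $\tau=\mathrm{Im}\langle\Gamma'',\Gamma'\rangle+3\kappa^2$, with $\Gamma$ any Wilczynski lift. A frame field along $\gamma$ is a smooth map $A=(A_1,A_2,A_3):J\to G$ with $[A_1]=\gamma$; it is of first order if the first column of $A^{-1}A'$ has $(2,1)$ entry $0$ and $(3,1)$ entry $1$. *)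

theory Defs
  imports "HOL-Analysis.Analysis"
begin

section \<open>Smooth maps of one real variable\<close>

text \<open>Derivatives are taken within the domain, so they are one-sided at those end points of an
  interval that belong to it.\<close>

definition vderiv :: "real set \<Rightarrow> (real \<Rightarrow> 'a::real_normed_vector) \<Rightarrow> real \<Rightarrow> 'a" where
  "vderiv J f t = vector_derivative f (at t within J)"

definition smooth_on :: "real set \<Rightarrow> (real \<Rightarrow> 'a::real_normed_vector) \<Rightarrow> bool" where
  "smooth_on J f \<longleftrightarrow> (\<forall>n. \<forall>t\<in>J. (vderiv J ^^ n) f differentiable (at t within J))"

section \<open>The Hermitian space of signature (2,1) and its isometry group\<close>

definition hmat :: "complex^3^3" where
  "hmat = vector [vector [0, 0, \<i>], vector [0, 1, 0], vector [- \<i>, 0, 0]]"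

definition herm :: "complex^3 \<Rightarrow> complex^3 \<Rightarrow> complex" where
  "herm z w = (\<Sum>i\<in>UNIV. cnj (z $ i) * (hmat *v w) $ i)"

definition conj_transpose :: "complex^3^3 \<Rightarrow> complex^3^3" where
  "conj_transpose A = (\<chi> i j. cnj (A $ j $ i))"

definition isometry_group :: "(complex^3^3) set" where
  "isometry_group = {A. det A = 1 \<and> conj_transpose A ** hmat ** A = hmat}"

definition null_vectors :: "(complex^3) set" where
  "null_vectors = {z. z \<noteq> 0 \<and> herm z z = 0}"

text \<open>Determinant of the matrix with the given columns.\<close>

definition det3 :: "complex^3 \<Rightarrow> complex^3 \<Rightarrow> complex^3 \<Rightarrow> complex" where
  "det3 a b c = det (transpose (vector [a, b, c] :: complex^3^3))"

section \<open>The projective plane and the null quadric\<close>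

text \<open>A point of the complex projective plane is a complex line through the origin, regarded as
  a set of vectors; \<open>proj z\<close> is the point \<open>[z]\<close> for \<open>z \<noteq> 0\<close>.\<close>

definition proj :: "complex^3 \<Rightarrow> (complex^3) set" where
  "proj z = vec.span {z}"

definition null_quadric :: "(complex^3) set set" where
  "null_quadric = proj ` null_vectors"

text \<open>The affine charts: the chart with index \<open>k\<close> sends \<open>[z]\<close> to its representative with
  \<open>k\<close>-th coordinate 1, that is, to \<open>z\<close> divided by \<open>z\<^sub>k\<close>.\<close>

definition chart_domain :: "3 \<Rightarrow> (complex^3) set set" where
  "chart_domain k = {proj z | z. z $ k \<noteq> 0}"

definition affine_chart :: "3 \<Rightarrow> (complex^3) set \<Rightarrow> complex^3" where
  "affine_chart k L = (THE v. v \<in> L \<and> v $ k = 1)"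

text \<open>Smoothness as a map into the projective plane, which for maps with values in the embedded
  hypersurface \<open>null_quadric\<close> is smoothness into that hypersurface.\<close>

definition smooth_curve :: "real set \<Rightarrow> (real \<Rightarrow> (complex^3) set) \<Rightarrow> bool" where
  "smooth_curve J \<gamma> \<longleftrightarrow>
     (\<forall>t\<in>J. \<gamma> t \<in> null_quadric) \<and>
     (\<forall>k. openin (top_of_set J) {t\<in>J. \<gamma> t \<in> chart_domain k} \<and>
          smooth_on {t\<in>J. \<gamma> t \<in> chart_domain k} (\<lambda>t. affine_chart k (\<gamma> t)))"

section \<open>The contact form and transversal curves\<close>

text \<open>\<open>contact_form z v\<close> is the value of the contact form on the tangent vector represented by
  \<open>v\<close> at the point \<open>[z]\<close>. Taking the real part loses nothing: if \<open>v\<close> is the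
  velocity of a curve of null vectors through \<open>z\<close>, then \<open>herm z v\<close> is purely imaginary.
  Replacing the curve by a rescaled one does not change the value either.\<close>

definition contact_form :: "complex^3 \<Rightarrow> complex^3 \<Rightarrow> real" where
  "contact_form z v = Re (- \<i> * herm z v / (\<Sum>i\<in>UNIV. cnj (z $ i) * z $ i))"

text \<open>The contact form on the velocity of the curve, computed with the local lift which one of the
  affine charts around the point provides.\<close>

definition contact_velocity :: "real set \<Rightarrow> (real \<Rightarrow> (complex^3) set) \<Rightarrow> real \<Rightarrow> real" where
  "contact_velocity J \<gamma> t =
     (let k = (SOME k. \<gamma> t \<in> chart_domain k);
          v = (\<lambda>s. affine_chart k (\<gamma> s))
      in contact_form (v t) (vderiv {s\<in>J. \<gamma> s \<in> chart_domain k} v t))"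

definition transversal :: "real set \<Rightarrow> (real \<Rightarrow> (complex^3) set) \<Rightarrow> bool" where
  "transversal J \<gamma> \<longleftrightarrow> (\<forall>t\<in>J. contact_velocity J \<gamma> t \<noteq> 0)"

definition positively_parametrized :: "real set \<Rightarrow> (real \<Rightarrow> (complex^3) set) \<Rightarrow> bool" where
  "positively_parametrized J \<gamma> \<longleftrightarrow> (\<forall>t\<in>J. contact_velocity J \<gamma> t > 0)"

section \<open>Lifts, natural parametrizations, bending and twist\<close>

definition is_lift :: "real set \<Rightarrow> (real \<Rightarrow> (complex^3) set) \<Rightarrow> (real \<Rightarrow> complex^3) \<Rightarrow> bool" where
  "is_lift J \<gamma> \<Gamma> \<longleftrightarrow>
     smooth_on J \<Gamma> \<and> (\<forall>t\<in>J. \<Gamma> t \<in> null_vectors \<and> \<gamma> t = proj (\<Gamma> t))"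

text \<open>Rescaling a lift by \<open>f\<close> multiplies the determinant below by the cube of \<open>f\<close>, so
  genericity does not depend on the lift.\<close>

definition generic :: "real set \<Rightarrow> (real \<Rightarrow> (complex^3) set) \<Rightarrow> bool" where
  "generic J \<gamma> \<longleftrightarrow>
     (\<exists>\<Gamma>. is_lift J \<gamma> \<Gamma> \<and>
          (\<forall>t\<in>J. det3 (\<Gamma> t) (vderiv J \<Gamma> t) (vderiv J (vderiv J \<Gamma>) t) \<noteq> 0))"

definition wilczynski_lift ::
    "real set \<Rightarrow> (real \<Rightarrow> (complex^3) set) \<Rightarrow> (real \<Rightarrow> complex^3) \<Rightarrow> bool" where
  "wilczynski_lift J \<gamma> \<Gamma> \<longleftrightarrow>
     is_lift J \<gamma> \<Gamma> \<and>
     (\<forall>t\<in>J. det3 (\<Gamma> t) (vderiv J \<Gamma> t) (vderiv J (vderiv J \<Gamma>) t) = - 1)"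

definition natural_parametrization :: "real set \<Rightarrow> (real \<Rightarrow> (complex^3) set) \<Rightarrow> bool" where
  "natural_parametrization J \<gamma> \<longleftrightarrow>
     (\<exists>\<Gamma>. wilczynski_lift J \<gamma> \<Gamma> \<and>
          (\<forall>t\<in>J. \<i> * inverse (herm (\<Gamma> t) (vderiv J \<Gamma> t)) = 1))"

text \<open>Wilczynski lifts differ by a constant cube root of unity, hence the choice made here is
  immaterial. The real part in the bending is harmless since \<open>herm v v\<close> is real.\<close>

definition bending :: "real set \<Rightarrow> (real \<Rightarrow> (complex^3) set) \<Rightarrow> real \<Rightarrow> real" where
  "bending J \<gamma> t =
     (let \<Gamma> = (SOME \<Gamma>. wilczynski_lift J \<gamma> \<Gamma>)
      in 1 / 2 * Re (herm (vderiv J \<Gamma> t) (vderiv J \<Gamma> t)))"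

definition twist :: "real set \<Rightarrow> (real \<Rightarrow> (complex^3) set) \<Rightarrow> real \<Rightarrow> real" where
  "twist J \<gamma> t =
     (let \<Gamma> = (SOME \<Gamma>. wilczynski_lift J \<gamma> \<Gamma>)
      in Im (herm (vderiv J (vderiv J \<Gamma>) t) (vderiv J \<Gamma> t)) + 3 * (bending J \<gamma> t)\<^sup>2)"

section \<open>Frame fields\<close>

definition frame_field ::
    "real set \<Rightarrow> (real \<Rightarrow> (complex^3) set) \<Rightarrow> (real \<Rightarrow> complex^3^3) \<Rightarrow> bool" where
  "frame_field J \<gamma> A \<longleftrightarrow>
     smooth_on J A \<and> (\<forall>t\<in>J. A t \<in> isometry_group \<and> proj (column 1 (A t)) = \<gamma> t)"

definition first_order_frame ::
    "real set \<Rightarrow> (real \<Rightarrow> (complex^3) set) \<Rightarrow> (real \<Rightarrow> complex^3^3) \<Rightarrow> bool" where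
  "first_order_frame J \<gamma> A \<longleftrightarrow>
     frame_field J \<gamma> A \<and>
     (\<forall>t\<in>J. (matrix_inv (A t) ** vderiv J A t) $ 2 $ 1 = 0 \<and>
            (matrix_inv (A t) ** vderiv J A t) $ 3 $ 1 = 1)"

definition wilczynski_matrix :: "real \<Rightarrow> real \<Rightarrow> complex^3^3" where
  "wilczynski_matrix \<kappa> \<tau> =
     vector [vector [\<i> * of_real \<kappa>, - \<i>, of_real \<tau>],
             vector [0, - 2 * \<i> * of_real \<kappa>, 1],
             vector [1, 0, \<i> * of_real \<kappa>]]"

definition wilczynski_frame ::
    "real set \<Rightarrow> (real \<Rightarrow> (complex^3) set) \<Rightarrow> (real \<Rightarrow> complex^3^3) \<Rightarrow> bool" where
  "wilczynski_frame J \<gamma> F \<longleftrightarrow>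
     first_order_frame J \<gamma> F \<and>
     wilczynski_lift J \<gamma> (\<lambda>t. column 1 (F t)) \<and>
     (\<forall>t\<in>J. matrix_inv (F t) ** vderiv J F t = wilczynski_matrix (bending J \<gamma> t) (twist J \<gamma> t))"

end

theory Submission
  imports Defs
begin

text \<open>
  Start from a natural Wilczynski lift \<open>\<Gamma>\<close>, so that \<open>\<langle>\<Gamma>, \<Gamma>'\<rangle> = i\<close>. The prescribed matrix forces
  \<open>F\<^sub>1 = \<Gamma>\<close>, \<open>F\<^sub>3 = \<Gamma>' - i\<kappa>\<Gamma>\<close> and \<open>F\<^sub>2 = F\<^sub>3' - \<tau>\<Gamma> - i\<kappa>F\<^sub>3\<close>. Differentiating \<open>\<langle>\<Gamma>, \<Gamma>'\<rangle> = i\<close> and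
  \<open>\<langle>\<Gamma>', \<Gamma>'\<rangle> = 2\<kappa>\<close> gives all products of these vectors except \<open>\<langle>F\<^sub>2, F\<^sub>2\<rangle>\<close>, which is 1 because the
  determinant of the frame is \<open>- det(\<Gamma>, \<Gamma>', \<Gamma>'') = 1\<close>. The derivative of \<open>F\<^sub>2\<close> then follows from
  the constancy of the Gram matrix and of the determinant. For uniqueness, two Wilczynski lifts
  differ by a smooth function with cube 1, hence by a constant, and the first column determines
  the frame.
\<close>

section \<open>Calculus of smooth maps on an interval\<close>

lemma smooth_on_vderiv: "smooth_on J f \<Longrightarrow> smooth_on J (vderiv J f)"
  unfolding smooth_on_def by (metis comp_apply funpow_Suc_right)

lemma smooth_on_has_vderiv:
  assumes "smooth_on J f" "t \<in> J"
  shows "(f has_vector_derivative vderiv J f t) (at t within J)"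
proof -
  have "f differentiable (at t within J)"
    using assms unfolding smooth_on_def by (metis funpow_0)
  then show ?thesis
    unfolding vderiv_def by (simp add: vector_derivative_works)
qed

text \<open>The Leibniz rule turns one product into a sum of two, so single products are not closed
  under differentiation. Finite sums of products are, which makes them a suitable class for
  coinduction.\<close>

inductive sum_of_products ::
    "real set \<Rightarrow> ('a::real_normed_vector \<Rightarrow> 'b::real_normed_vector \<Rightarrow> 'c::real_normed_vector)
      \<Rightarrow> (real \<Rightarrow> 'c) \<Rightarrow> bool"
  for J p where
  prod: "smooth_on J f \<Longrightarrow> smooth_on J g \<Longrightarrow> sum_of_products J p (\<lambda>t. p (f t) (g t))"
| add: "sum_of_products J p h \<Longrightarrow> sum_of_products J p k \<Longrightarrow> sum_of_products J p (\<lambda>t. h t + k t)"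

text \<open>A nonempty interior makes every point of \<open>J\<close> a limit point of
  \<open>J\<close>, so derivatives within \<open>J\<close> are unique, at end points too.\<close>

locale nontrivial_interval =
  fixes J :: "real set"
  assumes is_interval: "is_interval J"
    and interior_nonempty: "interior J \<noteq> {}"
begin

lemma at_within_neq_bot:
  assumes "t \<in> J"
  shows "at t within J \<noteq> bot"
proof -
  have "connected J" using is_interval is_interval_connected by blast
  moreover have "J \<noteq> {a}" for a
    using interior_nonempty by auto
  ultimately have "t islimpt J"
    using assms connected_imp_perfect by blast
  then show ?thesis by (simp add: trivial_limit_within)
qed

lemma vderiv_eqI:
  "(f has_vector_derivative f') (at t within J) \<Longrightarrow> t \<in> J \<Longrightarrow> vderiv J f t = f'"
  unfolding vderiv_def
  using at_within_neq_bot vector_derivative_within by blast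

lemma has_vderiv_cong:
  assumes "(f has_vector_derivative f') (at t within J)" "t \<in> J" "\<And>s. s \<in> J \<Longrightarrow> f s = g s"
  shows "(g has_vector_derivative f') (at t within J)"
  using assms has_vector_derivative_transform by metis

lemma vderiv_cong:
  assumes "\<And>s. s \<in> J \<Longrightarrow> f s = g s" "t \<in> J" "smooth_on J f"
  shows "vderiv J g t = vderiv J f t"
  using has_vderiv_cong[OF smooth_on_has_vderiv[OF assms(3,2)] assms(2,1)] assms(2)
  by (rule vderiv_eqI)

text \<open>By induction on the order, every iterated derivative agrees on \<open>J\<close> with a
  member of the class \<open>P\<close>. The comparison is made on \<open>J\<close> only, because
  \<open>vderiv\<close> is not controlled elsewhere.\<close>

lemma smooth_on_coinduct:
  assumes "P f"
    and step: "\<And>f. P f \<Longrightarrow> \<exists>f'. (\<forall>t\<in>J. (f has_vector_derivative f' t) (at t within J)) \<and> P f'"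
  shows "smooth_on J f"
proof -
  have "\<exists>g. P g \<and> (\<forall>t\<in>J. (vderiv J ^^ n) f t = g t)" for n
  proof (induction n)
    case 0
    then show ?case using \<open>P f\<close> by auto
  next
    case (Suc n)
    then obtain g where g: "P g" "\<And>t. t \<in> J \<Longrightarrow> (vderiv J ^^ n) f t = g t" by blast
    obtain g' where g': "\<forall>t\<in>J. (g has_vector_derivative g' t) (at t within J)" "P g'"
      using step[OF g(1)] by blast
    have "(vderiv J ^^ Suc n) f t = g' t" if "t \<in> J" for t
    proof -
      have "((vderiv J ^^ n) f has_vector_derivative g' t) (at t within J)"
        using g'(1) g(2) that by (auto intro: has_vderiv_cong)
      then show ?thesis using that by (simp add: vderiv_eqI)
    qed
    with g'(2) show ?case by blast
  qed note approx = this
  have "(vderiv J ^^ n) f differentiable (at t within J)" if t: "t \<in> J" for n t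
  proof -
    obtain g where g: "P g" "\<And>t. t \<in> J \<Longrightarrow> (vderiv J ^^ n) f t = g t"
      using approx[of n] by blast
    obtain g' where "(g has_vector_derivative g' t) (at t within J)"
      using step[OF g(1)] t by blast
    then have "((vderiv J ^^ n) f has_vector_derivative g' t) (at t within J)"
      by (rule has_vderiv_cong) (simp_all add: g(2) t)
    then show ?thesis by (rule differentiableI_vector)
  qed
  then show ?thesis unfolding smooth_on_def by blast
qed

lemma smooth_on_cong:
  assumes "smooth_on J f" "\<And>s. s \<in> J \<Longrightarrow> f s = g s"
  shows "smooth_on J g"
proof (rule smooth_on_coinduct[where P = "\<lambda>g. \<exists>f. smooth_on J f \<and> (\<forall>s\<in>J. f s = g s)"])
  show "\<exists>f. smooth_on J f \<and> (\<forall>s\<in>J. f s = g s)" using assms by blast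
next
  fix g :: "real \<Rightarrow> 'a"
  assume "\<exists>f. smooth_on J f \<and> (\<forall>s\<in>J. f s = g s)"
  then obtain f where f: "smooth_on J f" "\<And>s. s \<in> J \<Longrightarrow> f s = g s" by blast
  have "(g has_vector_derivative vderiv J f t) (at t within J)" if "t \<in> J" for t
    using smooth_on_has_vderiv[OF f(1) that] that f(2) by (rule has_vderiv_cong)
  then show "\<exists>f'. (\<forall>t\<in>J. (g has_vector_derivative f' t) (at t within J)) \<and>
      (\<exists>f. smooth_on J f \<and> (\<forall>s\<in>J. f s = f' s))"
    by (intro exI[of _ "vderiv J f"]) (use f(1) smooth_on_vderiv in auto)
qed

section \<open>Closure of smooth maps under linear and bilinear operations\<close>

lemma smooth_on_linear:
  assumes T: "bounded_linear T" and f: "smooth_on J f"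
  shows "smooth_on J (\<lambda>t. T (f t))"
proof (rule smooth_on_coinduct[where P = "\<lambda>h. \<exists>f. smooth_on J f \<and> h = (\<lambda>t. T (f t))"])
  show "\<exists>g. smooth_on J g \<and> (\<lambda>t. T (f t)) = (\<lambda>t. T (g t))" using f by (intro exI[of _ f]) simp
next
  fix h
  assume "\<exists>f. smooth_on J f \<and> h = (\<lambda>t. T (f t))"
  then obtain f where "smooth_on J f" "h = (\<lambda>t. T (f t))" by blast
  then show "\<exists>f'. (\<forall>t\<in>J. (h has_vector_derivative f' t) (at t within J)) \<and>
      (\<exists>f. smooth_on J f \<and> f' = (\<lambda>t. T (f t)))"
    by (intro exI[of _ "\<lambda>t. T (vderiv J f t)"] exI[of _ "vderiv J f"] conjI ballI)
      (simp_all add: bounded_linear.has_vector_derivative[OF T] smooth_on_has_vderiv smooth_on_vderiv)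
qed

lemma vderiv_linear:
  assumes "bounded_linear T" "smooth_on J f" "t \<in> J"
  shows "vderiv J (\<lambda>t. T (f t)) t = T (vderiv J f t)"
  by (rule vderiv_eqI[OF bounded_linear.has_vector_derivative[OF assms(1)]])
    (simp_all add: assms smooth_on_has_vderiv)

lemma smooth_on_const: "smooth_on J (\<lambda>t. c)"
  by (rule smooth_on_coinduct[where P = "\<lambda>h. \<exists>c. h = (\<lambda>t. c)"])
    (auto intro!: exI[of _ "\<lambda>t. 0"])

lemma smooth_on_add:
  assumes "smooth_on J f" "smooth_on J g"
  shows "smooth_on J (\<lambda>t. f t + g t)"
proof (rule smooth_on_coinduct[where
      P = "\<lambda>h. \<exists>f g. smooth_on J f \<and> smooth_on J g \<and> h = (\<lambda>t. f t + g t)"])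
  show "\<exists>f' g'. smooth_on J f' \<and> smooth_on J g' \<and> (\<lambda>t. f t + g t) = (\<lambda>t. f' t + g' t)"
    using assms by (intro exI[of _ f] exI[of _ g]) simp
next
  fix h :: "real \<Rightarrow> 'a"
  assume "\<exists>f g. smooth_on J f \<and> smooth_on J g \<and> h = (\<lambda>t. f t + g t)"
  then obtain f g where "smooth_on J f" "smooth_on J g" "h = (\<lambda>t. f t + g t)" by blast
  then show "\<exists>h'. (\<forall>t\<in>J. (h has_vector_derivative h' t) (at t within J)) \<and>
      (\<exists>f g. smooth_on J f \<and> smooth_on J g \<and> h' = (\<lambda>t. f t + g t))"
    by (intro exI[of _ "\<lambda>t. vderiv J f t + vderiv J g t"] exI[of _ "vderiv J f"]
        exI[of _ "vderiv J g"] conjI ballI)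
      (simp_all add: has_vector_derivative_add smooth_on_has_vderiv smooth_on_vderiv)
qed

lemma smooth_on_diff:
  assumes "smooth_on J f" "smooth_on J g"
  shows "smooth_on J (\<lambda>t. f t - g t)"
  using smooth_on_add[OF assms(1) smooth_on_linear[OF bounded_linear_minus[OF bounded_linear_ident] assms(2)]]
  by simp

lemma smooth_on_sum:
  assumes "\<And>i. i \<in> I \<Longrightarrow> smooth_on J (f i)"
  shows "smooth_on J (\<lambda>t. \<Sum>i\<in>I. f i t)"
  using assms by (induction I rule: infinite_finite_induct) (auto intro: smooth_on_const smooth_on_add)

text \<open>Real bilinearity covers the Hermitian form, scalar multiplication and products of
  numbers at once.\<close>

lemma smooth_on_bilinear:
  assumes p: "bounded_bilinear p" and "smooth_on J f" "smooth_on J g"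
  shows "smooth_on J (\<lambda>t. p (f t) (g t))"
proof (rule smooth_on_coinduct[where P = "sum_of_products J p"])
  show "sum_of_products J p (\<lambda>t. p (f t) (g t))"
    using assms sum_of_products.prod by blast
next
  fix h
  assume "sum_of_products J p h"
  then show "\<exists>h'. (\<forall>t\<in>J. (h has_vector_derivative h' t) (at t within J)) \<and> sum_of_products J p h'"
  proof induction
    case (prod f g)
    have "sum_of_products J p (\<lambda>t. p (f t) (vderiv J g t) + p (vderiv J f t) (g t))"
      using prod by (intro sum_of_products.intros smooth_on_vderiv)
    then show ?case
      using bounded_bilinear.has_vector_derivative[OF p smooth_on_has_vderiv smooth_on_has_vderiv] prod
      by (intro exI[of _ "\<lambda>t. p (f t) (vderiv J g t) + p (vderiv J f t) (g t)"]) blast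
  next
    case (add h k)
    then obtain h' k' where "\<forall>t\<in>J. (h has_vector_derivative h' t) (at t within J)"
      "\<forall>t\<in>J. (k has_vector_derivative k' t) (at t within J)"
      "sum_of_products J p h'" "sum_of_products J p k'" by blast
    then show ?case
      by (intro exI[of _ "\<lambda>t. h' t + k' t"])
        (auto intro: sum_of_products.add has_vector_derivative_add)
  qed
qed

lemma vderiv_bilinear:
  assumes "bounded_bilinear p" "smooth_on J f" "smooth_on J g" "t \<in> J"
  shows "vderiv J (\<lambda>t. p (f t) (g t)) t = p (f t) (vderiv J g t) + p (vderiv J f t) (g t)"
  by (rule vderiv_eqI[OF bounded_bilinear.has_vector_derivative[OF assms(1)]])
    (simp_all add: assms smooth_on_has_vderiv)

text \<open>A vector is the sum of its components placed on the axes, and each placement is a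
  bounded linear map.\<close>

lemma smooth_on_vec:
  fixes f :: "real \<Rightarrow> 'a::real_normed_vector ^ 'n"
  assumes "\<And>i. smooth_on J (\<lambda>t. f t $ i)"
  shows "smooth_on J f"
proof -
  have lin: "bounded_linear (axis i :: 'a \<Rightarrow> 'a ^ 'n)" for i
    by (rule bounded_linear_intro[where K = 1])
      (auto simp: vec_eq_iff axis_def norm_vec_def L2_set_def if_distrib[of norm]
        if_distrib[of "\<lambda>x. x\<^sup>2"] cong: if_cong)
  have "smooth_on J (\<lambda>t. \<Sum>i\<in>UNIV. axis i (f t $ i))"
    by (intro smooth_on_sum smooth_on_linear[OF lin] assms)
  moreover have "(\<Sum>i\<in>UNIV. axis i (f t $ i)) = f t" for t
    by (simp add: vec_eq_iff axis_def if_distrib cong: if_cong)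
  ultimately show ?thesis by simp
qed

lemma vderiv_zero_imp_constant:
  assumes "smooth_on J f" "\<And>t. t \<in> J \<Longrightarrow> vderiv J f t = 0"
  obtains c where "\<And>t. t \<in> J \<Longrightarrow> f t = c"
proof -
  have "convex J" using is_interval is_interval_convex_1 by blast
  moreover have "(f has_vector_derivative 0) (at t within J)" if "t \<in> J" for t
    using assms smooth_on_has_vderiv that by metis
  ultimately show ?thesis
    using has_vector_derivative_zero_constant that by blast
qed

end


section \<open>Algebra of the Hermitian form\<close>

lemma herm_coords:
  "herm z w = \<i> * cnj (z $ 1) * w $ 3 + cnj (z $ 2) * w $ 2 - \<i> * cnj (z $ 3) * w $ 1"
  by (simp add: herm_def hmat_def matrix_vector_mult_def sum_3)

lemma herm_simps:
  "herm (x + y) z = herm x z + herm y z"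
  "herm z (x + y) = herm z x + herm z y"
  "herm (x - y) z = herm x z - herm y z"
  "herm z (x - y) = herm z x - herm z y"
  "herm (c *s x) z = cnj c * herm x z"
  "herm z (c *s x) = c * herm z x"
  "herm 0 z = 0" "herm z 0 = 0"
  by (simp_all add: herm_coords algebra_simps)

lemma cnj_herm: "cnj (herm z w) = herm w z"
  by (simp add: herm_coords)

lemma herm_self_real: "herm z z = of_real (Re (herm z z))"
  by (metis cnj_herm complex_cnj_cancel_iff of_real_Re Reals_cnj_iff)

text \<open>Conjugate linearity is linearity over the reals, and finite dimension supplies the
  bound. This gives the Leibniz rule for the form.\<close>

lemma bounded_bilinear_herm: "bounded_bilinear herm"
  unfolding bilinear_conv_bounded_bilinear[symmetric] bilinear_def
  by (auto intro!: linearI simp: herm_coords algebra_simps scaleR_conv_of_real[where 'a = complex])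

lemma bounded_bilinear_vector_scalar_mult:
  "bounded_bilinear ((*s) :: complex \<Rightarrow> complex^'n \<Rightarrow> complex^'n)"
  unfolding bilinear_conv_bounded_bilinear[symmetric] bilinear_def
  by (auto intro!: linearI simp: vec_eq_iff algebra_simps scaleR_conv_of_real[where 'a = complex])

lemma bounded_linear_vector_scalar_mult: "bounded_linear ((*s) c :: complex^'n \<Rightarrow> complex^'n)"
  by (rule bounded_bilinear.bounded_linear_right[OF bounded_bilinear_vector_scalar_mult])

lemma bounded_linear_column: "bounded_linear (column k :: complex^'n^'m \<Rightarrow> complex^'m)"
  unfolding linear_conv_bounded_linear[symmetric]
  by (auto intro!: linearI simp: column_def vec_eq_iff)

lemma det3_coords:
  "det3 a b c = a $ 1 * (b $ 2 * c $ 3 - b $ 3 * c $ 2)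
    - a $ 2 * (b $ 1 * c $ 3 - b $ 3 * c $ 1)
    + a $ 3 * (b $ 1 * c $ 2 - b $ 2 * c $ 1)"
  by (simp add: det3_def det_3 transpose_def algebra_simps)

lemma column_transpose_vector:
  "column 1 (transpose (vector [a, b, c] :: complex^3^3)) = a"
  "column 2 (transpose (vector [a, b, c] :: complex^3^3)) = b"
  "column 3 (transpose (vector [a, b, c] :: complex^3^3)) = c"
  by (simp_all add: column_def transpose_def vec_eq_iff)

section \<open>Gram matrices and the isometry group\<close>

lemma gram_entry: "(conj_transpose A ** hmat ** A) $ i $ j = herm (column i A) (column j A)"
  by (simp add: herm_coords column_def conj_transpose_def hmat_def matrix_matrix_mult_def sum_3)

lemma det_hmat: "det hmat = -1"
  by (simp add: det_3 hmat_def)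

lemma det_conj_transpose: "det (conj_transpose A) = cnj (det A)"
  by (simp add: det_3 conj_transpose_def algebra_simps)

lemma hmat_involution: "hmat ** hmat = mat 1"
  by (simp add: hmat_def matrix_matrix_mult_def vec_eq_iff forall_3 sum_3 mat_def)

text \<open>The product of \<open>b\<close> with itself comes from determinants: the Gram matrix has
  determinant \<open>det hmat\<close> times the squared modulus of \<open>det A\<close>, that is -1,
  and expanding it by its entries gives \<open>- herm b b\<close>.\<close>

lemma in_isometry_groupI:
  assumes "det3 a b c = 1"
    and "herm a a = 0" "herm a b = 0" "herm a c = \<i>" "herm c b = 0" "herm c c = 0"
  shows "transpose (vector [a, b, c]) \<in> isometry_group"
proof -
  define A where "A = transpose (vector [a, b, c] :: complex^3^3)"
  let ?G = "conj_transpose A ** hmat ** A"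
  have rev: "herm b a = 0" "herm c a = - \<i>" "herm b c = 0"
    using assms by (metis cnj_herm complex_cnj_zero complex_cnj_i)+
  have entries: "?G $ i $ j = herm (column i A) (column j A)" for i j
    by (rule gram_entry)
  note cols = column_transpose_vector[of a b c, folded A_def]
  have "det A = 1" using assms(1) by (simp add: A_def det3_def)
  then have "det ?G = -1" by (simp add: det_mul det_hmat det_conj_transpose)
  moreover have "det ?G = - herm b b"
    unfolding det_3 entries cols by (simp add: assms rev algebra_simps)
  ultimately have "herm b b = 1" by simp
  then have "?G = hmat"
    unfolding vec_eq_iff forall_3 entries cols by (simp add: assms rev hmat_def)
  with \<open>det A = 1\<close> show ?thesis by (simp add: isometry_group_def A_def)
qed

text \<open>The basis dual to the columns of an isometry \<open>A\<close> is read off from \<open>A h A\<^sup>* h = 1\<close>.\<close>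

lemma isometry_expansion:
  assumes "A \<in> isometry_group"
  shows "u = (\<i> * herm (column 3 A) u) *s column 1 A + herm (column 2 A) u *s column 2 A
    + (- \<i> * herm (column 1 A) u) *s column 3 A"
    (is "_ = ?v")
proof -
  let ?B = "hmat ** (conj_transpose A ** hmat)"
  have "?B ** A = hmat ** (conj_transpose A ** hmat ** A)"
    by (simp add: matrix_mul_assoc)
  also have "\<dots> = mat 1"
    using assms by (simp add: isometry_group_def hmat_involution)
  \<comment> \<open>A left inverse of a square matrix is also a right inverse; the right inverse is
    what expands \<open>u\<close> in the columns of \<open>A\<close>.\<close>
  finally have "A ** ?B = mat 1" using matrix_left_right_inverse by blast
  then have "u = A *v (hmat *v (conj_transpose A *v (hmat *v u)))"
    by (metis matrix_vector_mul_assoc matrix_vector_mul_lid)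
  also have "\<dots> = ?v"
    by (simp add: vec_eq_iff forall_3 herm_coords column_def conj_transpose_def hmat_def
        matrix_vector_mult_def sum_3 algebra_simps)
  finally show ?thesis .
qed

text \<open>For a frame with F' = F W these are the right-hand sides of its Frenet equations, one
  per column.\<close>

lemma matrix_mult_wilczynski_matrix:
  "column 1 (A ** wilczynski_matrix \<kappa> \<tau>) = (\<i> * of_real \<kappa>) *s column 1 A + column 3 A"
  "column 2 (A ** wilczynski_matrix \<kappa> \<tau>)
    = (- \<i>) *s column 1 A - (2 * \<i> * of_real \<kappa>) *s column 2 A"
  "column 3 (A ** wilczynski_matrix \<kappa> \<tau>)
    = of_real \<tau> *s column 1 A + column 2 A + (\<i> * of_real \<kappa>) *s column 3 A"
  by (simp_all add: wilczynski_matrix_def column_def matrix_matrix_mult_def vec_eq_iff sum_3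
      algebra_simps)

lemma matrix_eq_columns3:
  fixes A B :: "complex^3^3"
  shows "A = B \<longleftrightarrow> column 1 A = column 1 B \<and> column 2 A = column 2 B \<and> column 3 A = column 3 B"
  by (auto simp: column_def vec_eq_iff forall_3)

lemma isometry_invertible: "A \<in> isometry_group \<Longrightarrow> invertible A"
  by (simp add: isometry_group_def invertible_det_nz)

lemma matrix_inv_mult_eq_iff:
  fixes A B C :: "complex^3^3"
  assumes "A \<in> isometry_group"
  shows "matrix_inv A ** B = C \<longleftrightarrow> B = A ** C"
proof -
  have "A ** matrix_inv A = mat 1" "matrix_inv A ** A = mat 1"
    using someI_ex[OF isometry_invertible[OF assms, unfolded invertible_def]]
    by (simp_all add: matrix_inv_def)
  then show ?thesis by (metis matrix_mul_assoc matrix_mul_lid)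
qed

lemma has_vector_derivative_det3:
  assumes "(a has_vector_derivative a') (at t within J)"
    and "(b has_vector_derivative b') (at t within J)"
    and "(c has_vector_derivative c') (at t within J)"
  shows "((\<lambda>t. det3 (a t) (b t) (c t)) has_vector_derivative
      det3 a' (b t) (c t) + det3 (a t) b' (c t) + det3 (a t) (b t) c') (at t within J)"
proof -
  note nth = assms[THEN bounded_linear.has_vector_derivative[OF bounded_linear_vec_nth]]
  show ?thesis
    unfolding det3_coords
    by (rule has_vector_derivative_eq_rhs,
        (rule has_vector_derivative_add has_vector_derivative_diff has_vector_derivative_mult nth)+)
      (simp add: algebra_simps)
qed

lemma proj_eq_imp_multiple:
  assumes "proj z = proj w"
  obtains c where "z = c *s w"
proof -
  have "z \<in> proj z" by (simp add: proj_def vec.span_base)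
  then show ?thesis
    using assms that by (auto simp: proj_def vec.span_singleton)
qed

text \<open>Roots of unity have modulus 1, so multiplication by \<epsilon> preserves the Hermitian
  form.\<close>

lemma cnj_mult_cube_root_of_unity:
  fixes \<epsilon> :: complex
  assumes "\<epsilon> ^ 3 = 1"
  shows "cnj \<epsilon> * \<epsilon> = 1"
proof -
  have "norm \<epsilon> = 1" using power_eq_1_iff[OF assms] by simp
  then show ?thesis using complex_norm_square[of \<epsilon>] by (simp add: mult.commute)
qed

section \<open>Wilczynski lifts and frames\<close>

locale natural_wilczynski_lift = nontrivial_interval +
  fixes \<gamma> :: "real \<Rightarrow> (complex^3) set" and \<Gamma> :: "real \<Rightarrow> complex^3"
  assumes lift: "wilczynski_lift J \<gamma> \<Gamma>"
    and natural: "\<And>t. t \<in> J \<Longrightarrow> herm (\<Gamma> t) (vderiv J \<Gamma> t) = \<i>"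
begin

abbreviation "\<Gamma>' \<equiv> vderiv J \<Gamma>"
abbreviation "\<Gamma>'' \<equiv> vderiv J \<Gamma>'"

lemma smooth_lift: "smooth_on J \<Gamma>" "smooth_on J \<Gamma>'" "smooth_on J \<Gamma>''"
  using lift by (simp_all add: wilczynski_lift_def is_lift_def smooth_on_vderiv)

lemma null_lift: "t \<in> J \<Longrightarrow> herm (\<Gamma> t) (\<Gamma> t) = 0"
  using lift by (simp add: wilczynski_lift_def is_lift_def null_vectors_def)

lemma det_lift: "t \<in> J \<Longrightarrow> det3 (\<Gamma> t) (\<Gamma>' t) (\<Gamma>'' t) = -1"
  using lift by (simp add: wilczynski_lift_def)

lemma natural': "t \<in> J \<Longrightarrow> herm (\<Gamma>' t) (\<Gamma> t) = - \<i>"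
  by (metis natural cnj_herm complex_cnj_i)

text \<open>Each constant product of two vector fields yields a linear relation for their
  derivatives.\<close>

lemma vderiv_herm:
  assumes "smooth_on J f" "smooth_on J g" "\<And>t. t \<in> J \<Longrightarrow> herm (f t) (g t) = c" "t \<in> J"
  shows "herm (f t) (vderiv J g t) + herm (vderiv J f t) (g t) = 0"
proof -
  have "((\<lambda>t. herm (f t) (g t)) has_vector_derivative 0) (at t within J)"
    by (rule has_vderiv_cong[where f = "\<lambda>t. c"]) (simp_all add: assms)
  then show ?thesis
    using vderiv_bilinear[OF bounded_bilinear_herm assms(1,2,4)] assms(4) by (simp add: vderiv_eqI)
qed

lemma vderiv_scale:
  assumes "smooth_on J f" "smooth_on J g" "t \<in> J"
  shows "vderiv J (\<lambda>t. f t *s g t) t = f t *s vderiv J g t + vderiv J f t *s (g t :: complex^'n)"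
  by (rule vderiv_bilinear[OF bounded_bilinear_vector_scalar_mult assms])

lemma smooth_on_scale:
  "smooth_on J f \<Longrightarrow> smooth_on J g \<Longrightarrow> smooth_on J (\<lambda>t. f t *s (g t :: complex^'n))"
  by (rule smooth_on_bilinear[OF bounded_bilinear_vector_scalar_mult])

text \<open>Since \<open>\<Gamma>\<close> is natural, the factor relating \<open>\<Delta>\<close> to \<open>\<Gamma>\<close> equals \<open>i \<langle>\<Gamma>', \<Delta>\<rangle>\<close>, hence is smooth.\<close>

lemma wilczynski_lift_unique:
  assumes "wilczynski_lift J \<gamma> \<Delta>"
  obtains \<epsilon> where "\<epsilon> ^ 3 = 1" "\<And>t. t \<in> J \<Longrightarrow> \<Delta> t = \<epsilon> *s \<Gamma> t"
proof -
  have sD: "smooth_on J \<Delta>" using assms by (simp add: wilczynski_lift_def is_lift_def)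
  define f where "f = (\<lambda>t. \<i> * herm (\<Gamma>' t) (\<Delta> t))"
  have sf: "smooth_on J f"
    unfolding f_def
    by (intro smooth_on_linear[OF bounded_linear_mult_right]
        smooth_on_bilinear[OF bounded_bilinear_herm] smooth_lift sD)
  have D: "f t *s \<Gamma> t = \<Delta> t" if "t \<in> J" for t
  proof -
    have "proj (\<Delta> t) = proj (\<Gamma> t)"
      using assms lift that by (auto simp: wilczynski_lift_def is_lift_def)
    then obtain c where c: "\<Delta> t = c *s \<Gamma> t" by (rule proj_eq_imp_multiple)
    \<comment> \<open>The form is linear in its second argument and the product of \<Gamma>' with
      \<Gamma> is -i, so the value is i c (-i) = c.\<close>
    then have "f t = c" by (simp add: f_def herm_simps natural' that mult.left_commute[of _ c])
    then show ?thesis using c by simp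
  qed
  let ?f' = "vderiv J f"
  have sf': "smooth_on J ?f'" by (rule smooth_on_vderiv[OF sf])
  have D': "f t *s \<Gamma>' t + ?f' t *s \<Gamma> t = vderiv J \<Delta> t" if "t \<in> J" for t
    using vderiv_cong[OF D that smooth_on_scale[OF sf smooth_lift(1)]]
      vderiv_scale[OF sf smooth_lift(1) that] by simp
  have D'': "vderiv J (vderiv J \<Delta>) t
      = f t *s \<Gamma>'' t + 2 *s (?f' t *s \<Gamma>' t) + vderiv J ?f' t *s \<Gamma> t" if "t \<in> J" for t
  proof -
    have "(vderiv J \<Delta> has_vector_derivative
        (f t *s \<Gamma>'' t + ?f' t *s \<Gamma>' t) + (?f' t *s \<Gamma>' t + vderiv J ?f' t *s \<Gamma> t)) (at t within J)"
      by (rule has_vderiv_cong[OF _ that D'],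
          intro has_vector_derivative_add
            bounded_bilinear.has_vector_derivative[OF bounded_bilinear_vector_scalar_mult]
            smooth_on_has_vderiv smooth_lift sf sf' that)
    then show ?thesis
      using vderiv_eqI that by (fastforce simp: vec_eq_iff algebra_simps)
  qed
  \<comment> \<open>In the determinant the terms with derivatives of \<open>f\<close> are multiples
    of other columns and drop out, leaving the cube of \<open>f\<close>. Both determinants equal
    -1.\<close>
  have cube: "f t * f t * f t = 1" if "t \<in> J" for t
  proof -
    have "-1 = det3 (\<Delta> t) (vderiv J \<Delta> t) (vderiv J (vderiv J \<Delta>) t)"
      using assms that by (simp add: wilczynski_lift_def)
    also have "\<dots> = f t * f t * f t * det3 (\<Gamma> t) (\<Gamma>' t) (\<Gamma>'' t)"
      unfolding D''[OF that] D'[OF that, symmetric] D[OF that, symmetric]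
      by (simp add: det3_coords algebra_simps)
    finally show ?thesis by (simp add: det_lift that)
  qed
  \<comment> \<open>Differentiating the cube of \<open>f\<close>, which is 1, gives 3 f f f' = 0,
    and \<open>f\<close> has no zero.\<close>
  have "?f' t = 0" if "t \<in> J" for t
  proof -
    note df = smooth_on_has_vderiv[OF sf that]
    have "((\<lambda>t. f t * f t * f t) has_vector_derivative 0) (at t within J)"
      by (rule has_vderiv_cong[where f = "\<lambda>t. 1"]) (simp_all add: cube that)
    then have "f t * f t * ?f' t + (f t * ?f' t + ?f' t * f t) * f t = 0"
      using has_vector_derivative_mult[OF has_vector_derivative_mult[OF df df] df, THEN vderiv_eqI]
      by (simp add: vderiv_eqI that)
    then have "3 * (f t * f t) * ?f' t = 0" by (simp add: algebra_simps)
    with cube[OF that] show ?thesis by auto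
  qed
  then obtain \<epsilon> where eps: "\<And>t. t \<in> J \<Longrightarrow> f t = \<epsilon>"
    using vderiv_zero_imp_constant[OF sf] by blast
  obtain t where "t \<in> J" using interior_nonempty interior_subset by blast
  then have "\<epsilon> ^ 3 = 1" using cube eps by (simp add: power3_eq_cube)
  then show ?thesis using that D eps by metis
qed

text \<open>Both invariants are defined through a lift picked by choice. That lift is \<epsilon>
  \<Gamma> with \<epsilon> of modulus 1, and such a factor cancels in every product.\<close>

lemma bending_twist_eq:
  assumes "t \<in> J"
  shows "bending J \<gamma> t = Re (herm (\<Gamma>' t) (\<Gamma>' t)) / 2"
    and "twist J \<gamma> t = Im (herm (\<Gamma>'' t) (\<Gamma>' t)) + 3 * (bending J \<gamma> t)\<^sup>2"
proof -
  define \<Delta> where "\<Delta> = (SOME \<Gamma>. wilczynski_lift J \<gamma> \<Gamma>)"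
  have "wilczynski_lift J \<gamma> \<Delta>" unfolding \<Delta>_def by (rule someI[of "wilczynski_lift J \<gamma>", OF lift])
  then obtain \<epsilon> where eps: "\<epsilon> ^ 3 = 1" "\<And>t. t \<in> J \<Longrightarrow> \<Delta> t = \<epsilon> *s \<Gamma> t"
    using wilczynski_lift_unique by blast
  note lin = bounded_linear_vector_scalar_mult[where 'n = 3, of \<epsilon>]
  have D': "vderiv J \<Delta> s = \<epsilon> *s \<Gamma>' s" if "s \<in> J" for s
    using vderiv_cong[of "\<lambda>t. \<epsilon> *s \<Gamma> t" \<Delta>, OF _ that smooth_on_linear[OF lin smooth_lift(1)]]
      vderiv_linear[OF lin smooth_lift(1) that] eps(2) by simp
  have D'': "vderiv J (vderiv J \<Delta>) t = \<epsilon> *s \<Gamma>'' t"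
    using vderiv_cong[of "\<lambda>t. \<epsilon> *s \<Gamma>' t", OF _ assms smooth_on_linear[OF lin smooth_lift(2)]]
      vderiv_linear[OF lin smooth_lift(2) assms] D' by simp
  have inv: "herm (\<epsilon> *s x) (\<epsilon> *s y) = herm x y" for x y
    using cnj_mult_cube_root_of_unity[OF eps(1)]
    by (simp add: herm_simps mult.commute[of "cnj \<epsilon>"] flip: mult.assoc)
  show "bending J \<gamma> t = Re (herm (\<Gamma>' t) (\<Gamma>' t)) / 2"
    by (simp add: bending_def Let_def D' assms inv flip: \<Delta>_def)
  show "twist J \<gamma> t = Im (herm (\<Gamma>'' t) (\<Gamma>' t)) + 3 * (bending J \<gamma> t)\<^sup>2"
    by (simp add: twist_def Let_def D' D'' assms inv flip: \<Delta>_def)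
qed

lemma smooth_on_bending: "smooth_on J (bending J \<gamma>)"
proof (rule smooth_on_cong)
  show "smooth_on J (\<lambda>t. Re (herm (\<Gamma>' t) (\<Gamma>' t)) / 2)"
    by (intro smooth_on_linear[OF bounded_linear_divide] smooth_on_linear[OF bounded_linear_Re]
        smooth_on_bilinear[OF bounded_bilinear_herm] smooth_lift)
qed (simp add: bending_twist_eq)

lemma smooth_on_twist: "smooth_on J (twist J \<gamma>)"
proof (rule smooth_on_cong)
  show "smooth_on J (\<lambda>t. Im (herm (\<Gamma>'' t) (\<Gamma>' t)) + 3 * (bending J \<gamma> t * bending J \<gamma> t))"
    by (intro smooth_on_add smooth_on_linear[OF bounded_linear_Im]
        smooth_on_linear[OF bounded_linear_mult_right] smooth_on_bilinear[OF bounded_bilinear_mult]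
        smooth_on_bilinear[OF bounded_bilinear_herm] smooth_lift smooth_on_bending)
qed (simp add: bending_twist_eq power2_eq_square)

text \<open>The second product comes from differentiating the naturality condition. In the third,
  the real part comes from differentiating the first product and the imaginary part from the
  definition of the twist, with a sign from exchanging the arguments.\<close>

lemma herm_lift_derivatives:
  assumes "t \<in> J"
  defines "\<kappa> \<equiv> bending J \<gamma>"
  shows "herm (\<Gamma>' t) (\<Gamma>' t) = 2 * of_real (\<kappa> t)"
    and "herm (\<Gamma> t) (\<Gamma>'' t) = - 2 * of_real (\<kappa> t)"
    and "herm (\<Gamma>' t) (\<Gamma>'' t) = of_real (vderiv J \<kappa> t) - \<i> * of_real (twist J \<gamma> t - 3 * (\<kappa> t)\<^sup>2)"
proof -
  have k: "herm (\<Gamma>' s) (\<Gamma>' s) = 2 * of_real (\<kappa> s)" if "s \<in> J" for s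
    using herm_self_real[of "\<Gamma>' s"] by (simp add: \<kappa>_def bending_twist_eq that)
  then show "herm (\<Gamma>' t) (\<Gamma>' t) = 2 * of_real (\<kappa> t)" using assms by blast
  then show "herm (\<Gamma> t) (\<Gamma>'' t) = - 2 * of_real (\<kappa> t)"
    using vderiv_herm[OF smooth_lift(1,2) natural assms(1)] by (simp add: eq_neg_iff_add_eq_0)
  have "((\<lambda>t. herm (\<Gamma>' t) (\<Gamma>' t)) has_vector_derivative of_real (2 * vderiv J \<kappa> t)) (at t within J)"
  proof (rule has_vderiv_cong)
    show "((\<lambda>t. complex_of_real (2 * \<kappa> t)) has_vector_derivative of_real (2 * vderiv J \<kappa> t))
        (at t within J)"
      unfolding \<kappa>_def
      by (intro bounded_linear.has_vector_derivative[OF bounded_linear_of_real]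
          bounded_linear.has_vector_derivative[OF bounded_linear_mult_right]
          smooth_on_has_vderiv smooth_on_bending assms)
  qed (simp_all add: k assms)
  then have "herm (\<Gamma>' t) (\<Gamma>'' t) + herm (\<Gamma>'' t) (\<Gamma>' t) = of_real (2 * vderiv J \<kappa> t)"
    using vderiv_bilinear[OF bounded_bilinear_herm smooth_lift(2,2) assms(1)] assms(1)
    by (simp add: vderiv_eqI)
  moreover have "herm (\<Gamma>'' t) (\<Gamma>' t) = cnj (herm (\<Gamma>' t) (\<Gamma>'' t))" by (simp add: cnj_herm)
  moreover from this have "Im (herm (\<Gamma>' t) (\<Gamma>'' t)) = - (twist J \<gamma> t - 3 * (\<kappa> t)\<^sup>2)"
    by (simp add: bending_twist_eq(2) assms)
  ultimately show "herm (\<Gamma>' t) (\<Gamma>'' t)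
      = of_real (vderiv J \<kappa> t) - \<i> * of_real (twist J \<gamma> t - 3 * (\<kappa> t)\<^sup>2)"
    by (simp add: complex_eq_iff)
qed

text \<open>The first and third columns of \<open>F' = F W\<close> leave no choice for the last two columns.\<close>

definition third_vector :: "real \<Rightarrow> complex^3" where
  "third_vector t = \<Gamma>' t - (\<i> * of_real (bending J \<gamma> t)) *s \<Gamma> t"

definition second_vector :: "real \<Rightarrow> complex^3" where
  "second_vector t = vderiv J third_vector t - of_real (twist J \<gamma> t) *s \<Gamma> t
     - (\<i> * of_real (bending J \<gamma> t)) *s third_vector t"

definition frame :: "real \<Rightarrow> complex^3^3" where
  "frame t = transpose (vector [\<Gamma> t, second_vector t, third_vector t])"

section \<open>Smoothness and Gram matrix of the frame\<close>

lemma smooth_on_coefficients: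
  "smooth_on J (\<lambda>t. complex_of_real (twist J \<gamma> t))"
  "smooth_on J (\<lambda>t. \<i> * complex_of_real (bending J \<gamma> t))"
  by (intro smooth_on_linear[OF bounded_linear_of_real] smooth_on_linear[OF bounded_linear_mult_right]
      smooth_on_twist smooth_on_bending)+

lemma smooth_on_third_vector: "smooth_on J third_vector"
  unfolding third_vector_def[abs_def]
  by (intro smooth_on_diff smooth_on_scale smooth_lift smooth_on_coefficients)

lemma smooth_on_second_vector: "smooth_on J second_vector"
  unfolding second_vector_def[abs_def]
  by (intro smooth_on_diff smooth_on_scale smooth_lift smooth_on_coefficients
      smooth_on_third_vector smooth_on_vderiv)

lemma column_frame:
  "column 1 (frame t) = \<Gamma> t" "column 2 (frame t) = second_vector t"
  "column 3 (frame t) = third_vector t"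
  unfolding frame_def by (rule column_transpose_vector)+

lemma smooth_on_frame: "smooth_on J frame"
proof -
  have "smooth_on J (\<lambda>t. column j (frame t))" for j
    using exhaust_3[of j] smooth_lift(1) smooth_on_second_vector smooth_on_third_vector
    by (auto simp: column_frame)
  then have "smooth_on J (\<lambda>t. column j (frame t) $ i)" for i j
    by (rule smooth_on_linear[OF bounded_linear_vec_nth])
  then have "smooth_on J (\<lambda>t. frame t $ i $ j)" for i j
    by (simp add: column_def)
  then show ?thesis by (intro smooth_on_vec)
qed

lemma vderiv_third_vector:
  assumes "t \<in> J"
  shows "vderiv J third_vector t = \<Gamma>'' t - (\<i> * of_real (bending J \<gamma> t)) *s \<Gamma>' t
    - (\<i> * of_real (vderiv J (bending J \<gamma>) t)) *s \<Gamma> t"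
proof -
  have "((\<lambda>t. \<i> * complex_of_real (bending J \<gamma> t)) has_vector_derivative
      \<i> * of_real (vderiv J (bending J \<gamma>) t)) (at t within J)"
    by (intro bounded_linear.has_vector_derivative[OF bounded_linear_of_real]
        bounded_linear.has_vector_derivative[OF bounded_linear_mult_right]
        smooth_on_has_vderiv smooth_on_bending assms)
  then have "(third_vector has_vector_derivative \<Gamma>'' t -
      ((\<i> * of_real (bending J \<gamma> t)) *s \<Gamma>' t + (\<i> * of_real (vderiv J (bending J \<gamma>) t)) *s \<Gamma> t))
      (at t within J)"
    unfolding third_vector_def[abs_def]
    by (intro has_vector_derivative_diff smooth_on_has_vderiv smooth_lift assms
        bounded_bilinear.has_vector_derivative[OF bounded_bilinear_vector_scalar_mult])
  then show ?thesis using vderiv_eqI assms by (fastforce simp: diff_diff_eq)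
qed

text \<open>Inserting the third vector and its derivative leaves only \<Gamma>, \<Gamma>' and
  \<Gamma>'', whose needed products are already computed.\<close>

lemma second_vector_eq:
  assumes "t \<in> J"
  defines "\<kappa> \<equiv> bending J \<gamma>"
  shows "second_vector t = \<Gamma>'' t - (2 * \<i> * of_real (\<kappa> t)) *s \<Gamma>' t
    - (\<i> * of_real (vderiv J \<kappa> t) + of_real (twist J \<gamma> t) + (of_real (\<kappa> t))\<^sup>2) *s \<Gamma> t"
  unfolding \<kappa>_def second_vector_def vderiv_third_vector[OF assms(1)] third_vector_def
  by (simp add: vec_eq_iff algebra_simps power2_eq_square)

lemma gram_frame:
  assumes t: "t \<in> J"
  shows "herm (\<Gamma> t) (second_vector t) = 0" "herm (\<Gamma> t) (third_vector t) = \<i>"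
    "herm (third_vector t) (second_vector t) = 0" "herm (third_vector t) (third_vector t) = 0"
    "det3 (\<Gamma> t) (second_vector t) (third_vector t) = 1"
proof -
  note rules = herm_simps null_lift[OF t] natural[OF t] natural'[OF t] herm_lift_derivatives[OF t]
  show "herm (\<Gamma> t) (second_vector t) = 0"
    unfolding second_vector_eq[OF t]
    by (simp only: rules, simp add: algebra_simps)
  show "herm (\<Gamma> t) (third_vector t) = \<i>"
    by (simp add: third_vector_def rules)
  \<comment> \<open>The terms in \<kappa>' and \<tau> cancel, and the squares of \<kappa> carry the
    coefficients 3 - 4 + 1 = 0 up to the factor i; the 3 is the one in the definition of the
    twist.\<close>
  show "herm (third_vector t) (second_vector t) = 0"
    unfolding second_vector_eq[OF t] third_vector_def
    by (simp only: rules, simp add: algebra_simps power2_eq_square)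
  show "herm (third_vector t) (third_vector t) = 0"
    by (simp add: third_vector_def rules algebra_simps)
  \<comment> \<open>Modulo \<Gamma> the third vector is \<Gamma>', and modulo \<Gamma> and \<Gamma>'
    the second is \<Gamma>''. Exchanging these two columns gives the sign.\<close>
  have "det3 (\<Gamma> t) (second_vector t) (third_vector t) = - det3 (\<Gamma> t) (\<Gamma>' t) (\<Gamma>'' t)"
    unfolding second_vector_eq[OF t] third_vector_def
    by (simp add: det3_coords algebra_simps)
  then show "det3 (\<Gamma> t) (second_vector t) (third_vector t) = 1"
    by (simp add: det_lift t)
qed

lemma frame_in_isometry_group: "t \<in> J \<Longrightarrow> frame t \<in> isometry_group"
  unfolding frame_def by (intro in_isometry_groupI gram_frame null_lift)

lemma herm_second_vector_self: "t \<in> J \<Longrightarrow> herm (second_vector t) (second_vector t) = 1"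
  using frame_in_isometry_group[of t] gram_entry[of "frame t" 2 2]
  by (simp add: isometry_group_def column_frame hmat_def)

section \<open>Frenet equations of the frame\<close>

lemma vderiv_first_vector:
  "\<Gamma>' t = (\<i> * of_real (bending J \<gamma> t)) *s \<Gamma> t + third_vector t"
  by (simp add: third_vector_def)

lemma vderiv_third_vector_frame:
  "vderiv J third_vector t = of_real (twist J \<gamma> t) *s \<Gamma> t + second_vector t
     + (\<i> * of_real (bending J \<gamma> t)) *s third_vector t"
  by (simp add: second_vector_def)

text \<open>Differentiating the Gram matrix and the determinant of the frame determines the components
  of the derivative of the second column.\<close>

lemma vderiv_second_vector:
  assumes t: "t \<in> J"
  shows "vderiv J second_vector t
    = (- \<i>) *s \<Gamma> t - (2 * \<i> * of_real (bending J \<gamma> t)) *s second_vector t"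
proof -
  let ?u = "vderiv J second_vector t"
  let ?F1 = "\<Gamma> t" and ?F2 = "second_vector t" and ?F3 = "third_vector t"
  note sm = smooth_lift(1) smooth_on_second_vector smooth_on_third_vector
  note rules = herm_simps gram_frame[OF t] herm_second_vector_self[OF t]
  \<comment> \<open>\<Gamma>' is a combination of \<open>?F1\<close> and \<open>?F3\<close>, both
    orthogonal to \<open>?F2\<close>.\<close>
  have 1: "herm ?F1 ?u = 0"
    using vderiv_herm[OF sm(1,2) gram_frame(1) t]
    by (simp add: vderiv_first_vector rules)
  \<comment> \<open>In the derivative of the third vector only the component along
    \<open>?F2\<close> pairs with \<open>?F2\<close>, and it contributes 1.\<close>
  have 3: "herm ?F3 ?u = -1"
  proof -
    have "herm ?F3 ?u + 1 = 0"
      using vderiv_herm[OF sm(3,2) gram_frame(3) t]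
      by (simp add: vderiv_third_vector_frame rules)
    then show ?thesis by (simp add: eq_neg_iff_add_eq_0)
  qed
  have expand: "?u = (- \<i>) *s ?F1 + herm ?F2 ?u *s ?F2"
    using isometry_expansion[OF frame_in_isometry_group[OF t], of ?u]
    by (simp add: column_frame 1 3)
  \<comment> \<open>The unit length of \<open>?F2\<close> would control only the real part of
    \<open>herm ?F2 ?u\<close>. The constant determinant says that the diagonal coefficients
    i\<kappa>, \<open>herm ?F2 ?u\<close> and i\<kappa> add up to 0.\<close>
  have "((\<lambda>t. det3 (\<Gamma> t) (second_vector t) (third_vector t)) has_vector_derivative 0)
      (at t within J)"
    by (rule has_vderiv_cong[where f = "\<lambda>t. 1"]) (simp_all add: gram_frame t)
  then have "det3 (\<Gamma>' t) ?F2 ?F3 + det3 ?F1 ?u ?F3 + det3 ?F1 ?F2 (vderiv J third_vector t) = 0"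
    using has_vector_derivative_det3[OF sm[THEN smooth_on_has_vderiv, OF t], THEN vderiv_eqI] t
    by (simp add: vderiv_eqI)
  moreover have "det3 (\<Gamma>' t) ?F2 ?F3 = \<i> * of_real (bending J \<gamma> t) * det3 ?F1 ?F2 ?F3"
    unfolding vderiv_first_vector by (simp add: det3_coords algebra_simps)
  moreover have "det3 ?F1 ?u ?F3 = herm ?F2 ?u * det3 ?F1 ?F2 ?F3"
    by (subst expand) (simp add: det3_coords algebra_simps)
  moreover have "det3 ?F1 ?F2 (vderiv J third_vector t)
      = \<i> * of_real (bending J \<gamma> t) * det3 ?F1 ?F2 ?F3"
    unfolding vderiv_third_vector_frame by (simp add: det3_coords algebra_simps)
  ultimately have "herm ?F2 ?u + 2 * \<i> * of_real (bending J \<gamma> t) = 0"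
    by (simp add: gram_frame t algebra_simps)
  then have "herm ?F2 ?u = - (2 * \<i> * of_real (bending J \<gamma> t))"
    by (simp add: eq_neg_iff_add_eq_0)
  with expand show ?thesis by (metis diff_conv_add_uminus vector_smult_lneg)
qed

lemma vderiv_frame:
  assumes "t \<in> J"
  shows "vderiv J frame t = frame t ** wilczynski_matrix (bending J \<gamma> t) (twist J \<gamma> t)"
proof -
  have "column j (vderiv J frame t) = vderiv J (\<lambda>t. column j (frame t)) t" for j
    by (rule vderiv_linear[OF bounded_linear_column smooth_on_frame assms, symmetric])
  then show ?thesis
    unfolding matrix_eq_columns3 matrix_mult_wilczynski_matrix
    by (simp add: column_frame vderiv_second_vector assms vderiv_third_vector_frame
        flip: vderiv_first_vector)
qed

lemma wilczynski_frame_frame: "wilczynski_frame J \<gamma> frame"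
proof -
  have "matrix_inv (frame t) ** vderiv J frame t = wilczynski_matrix (bending J \<gamma> t) (twist J \<gamma> t)"
    if "t \<in> J" for t
    using that matrix_inv_mult_eq_iff frame_in_isometry_group vderiv_frame by blast
  then show ?thesis
    using lift unfolding wilczynski_frame_def first_order_frame_def frame_field_def
    by (auto simp: column_frame smooth_on_frame frame_in_isometry_group wilczynski_lift_def
        is_lift_def wilczynski_matrix_def)
qed

end

section \<open>Determination of a Wilczynski frame by its first column\<close>

context nontrivial_interval
begin

text \<open>The first equation can be solved for the third column and the second one for the second
  column.\<close>

lemma wilczynski_frame_columns:
  assumes F: "wilczynski_frame J \<gamma> F" and t: "t \<in> J"
  shows "vderiv J (\<lambda>t. column 1 (F t)) t
      = (\<i> * of_real (bending J \<gamma> t)) *s column 1 (F t) + column 3 (F t)"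
    and "vderiv J (\<lambda>t. column 3 (F t)) t = of_real (twist J \<gamma> t) *s column 1 (F t)
      + column 2 (F t) + (\<i> * of_real (bending J \<gamma> t)) *s column 3 (F t)"
proof -
  have smooth: "smooth_on J F" and "F t \<in> isometry_group"
    using F t by (auto simp: wilczynski_frame_def first_order_frame_def frame_field_def)
  then have "vderiv J F t = F t ** wilczynski_matrix (bending J \<gamma> t) (twist J \<gamma> t)"
    using F t by (metis wilczynski_frame_def matrix_inv_mult_eq_iff)
  then have "vderiv J (\<lambda>t. column j (F t)) t
      = column j (F t ** wilczynski_matrix (bending J \<gamma> t) (twist J \<gamma> t))" for j
    using vderiv_linear[OF bounded_linear_column smooth t] by simp
  then show "vderiv J (\<lambda>t. column 1 (F t)) t
      = (\<i> * of_real (bending J \<gamma> t)) *s column 1 (F t) + column 3 (F t)"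
    and "vderiv J (\<lambda>t. column 3 (F t)) t = of_real (twist J \<gamma> t) *s column 1 (F t)
      + column 2 (F t) + (\<i> * of_real (bending J \<gamma> t)) *s column 3 (F t)"
    by (simp_all add: matrix_mult_wilczynski_matrix)
qed

lemma vderiv_scaled_cong:
  fixes f g :: "real \<Rightarrow> complex^'n"
  assumes "smooth_on J f" "\<And>t. t \<in> J \<Longrightarrow> g t = c *s f t" "t \<in> J"
  shows "vderiv J g t = c *s vderiv J f t"
  using vderiv_cong[of "\<lambda>t. c *s f t" g t] assms
    vderiv_linear[OF bounded_linear_vector_scalar_mult] smooth_on_linear[OF bounded_linear_vector_scalar_mult]
  by metis

text \<open>Bending and twist depend on the curve only, so both frames obey the same linear
  equations, and the constant factor passes through the derivatives.\<close>

lemma wilczynski_frame_eq_scaled: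
  assumes F: "wilczynski_frame J \<gamma> F" and F': "wilczynski_frame J \<gamma> F'"
    and first: "\<And>t. t \<in> J \<Longrightarrow> column 1 (F' t) = \<epsilon> *s column 1 (F t)"
    and t: "t \<in> J"
  shows "F' t = (\<chi> i j. \<epsilon> * F t $ i $ j)"
proof -
  have smooth: "smooth_on J (\<lambda>t. column j (F t))" for j
    using F by (intro smooth_on_linear[OF bounded_linear_column])
      (simp add: wilczynski_frame_def first_order_frame_def frame_field_def)
  \<comment> \<open>This is shown on all of \<open>J\<close>, since the derivative of the third
    column enters the second one.\<close>
  have third: "column 3 (F' s) = \<epsilon> *s column 3 (F s)" if "s \<in> J" for s
    using vderiv_scaled_cong[OF smooth first that] first[OF that]
      wilczynski_frame_columns(1)[OF F that] wilczynski_frame_columns(1)[OF F' that]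
    by (simp add: vec_eq_iff algebra_simps)
  have "column 2 (F' t) = \<epsilon> *s column 2 (F t)"
    using vderiv_scaled_cong[OF smooth third t] first[OF t] third[OF t]
      wilczynski_frame_columns(2)[OF F t] wilczynski_frame_columns(2)[OF F' t]
    by (simp add: vec_eq_iff algebra_simps)
  with first[OF t] third[OF t] show ?thesis
    by (simp add: column_def vec_eq_iff forall_3)
qed

end

theorem proposition3p7:
  fixes J :: "real set" and \<gamma> :: "real \<Rightarrow> (complex^3) set"
  assumes "is_interval J" and "interior J \<noteq> {}"
    and "smooth_curve J \<gamma>"
    and "transversal J \<gamma>" and "positively_parametrized J \<gamma>"
    and "generic J \<gamma>"
    and "natural_parametrization J \<gamma>"
  shows "(\<exists>F. wilczynski_frame J \<gamma> F) \<and>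
         (\<forall>F F'. wilczynski_frame J \<gamma> F \<longrightarrow> wilczynski_frame J \<gamma> F' \<longrightarrow>
            (\<exists>\<epsilon>::complex. \<epsilon> ^ 3 = 1 \<and> (\<forall>t\<in>J. F' t = (\<chi> i j. \<epsilon> * F t $ i $ j))))"
proof -
  interpret nontrivial_interval J by unfold_locales (use assms in auto)
  obtain \<Gamma> where lift: "wilczynski_lift J \<gamma> \<Gamma>"
    and nat: "\<And>t. t \<in> J \<Longrightarrow> \<i> * inverse (herm (\<Gamma> t) (vderiv J \<Gamma> t)) = 1"
    using assms(7) unfolding natural_parametrization_def by blast
  have "herm (\<Gamma> t) (vderiv J \<Gamma> t) = \<i>" if "t \<in> J" for t
    using nat[OF that] by (metis divide_inverse right_inverse_eq divide_eq_1_iff)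
  then interpret natural_wilczynski_lift J \<gamma> \<Gamma>
    by unfold_locales (use lift in auto)
  have "\<exists>\<epsilon>. \<epsilon> ^ 3 = 1 \<and> (\<forall>t\<in>J. F' t = (\<chi> i j. \<epsilon> * F t $ i $ j))"
    if F: "wilczynski_frame J \<gamma> F" and F': "wilczynski_frame J \<gamma> F'" for F F'
  proof -
    have lifts: "wilczynski_lift J \<gamma> (\<lambda>t. column 1 (F t))" "wilczynski_lift J \<gamma> (\<lambda>t. column 1 (F' t))"
      using F F' by (simp_all add: wilczynski_frame_def)
    \<comment> \<open>Both first columns are compared with the natural lift \<Gamma>; the required
      root of unity is the quotient \<open>b / a\<close>.\<close>
    obtain a where a: "a ^ 3 = 1" "\<And>t. t \<in> J \<Longrightarrow> column 1 (F t) = a *s \<Gamma> t"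
      using wilczynski_lift_unique[OF lifts(1)] by blast
    obtain b where b: "b ^ 3 = 1" "\<And>t. t \<in> J \<Longrightarrow> column 1 (F' t) = b *s \<Gamma> t"
      using wilczynski_lift_unique[OF lifts(2)] by blast
    have "a \<noteq> 0" using a(1) by auto
    have "column 1 (F' t) = (b / a) *s column 1 (F t)" if "t \<in> J" for t
      using a(2) b(2) that \<open>a \<noteq> 0\<close> by (simp add: vector_smult_assoc)
    then have "F' t = (\<chi> i j. b / a * F t $ i $ j)" if "t \<in> J" for t
      using wilczynski_frame_eq_scaled[OF F F'] that by blast
    moreover have "(b / a) ^ 3 = 1" using a(1) b(1) by (simp add: power_divide)
    ultimately show ?thesis by blast
  qed
  then show ?thesis using wilczynski_frame_frame by blast
qed

end
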